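(* Let $d\ge1$, $\alpha>0$, and let $F_k=e^{-V_k}$, $k=1,2$, be $d$-dimensional max-stable distribution functions with unit-$\alpha$-Fréchet margins and exponent functions $V_k$. Let $S$ be either the positive unit sphere of a norm on $\mathbb{R}^d$ or the sphere $S_\tau=\{s\in[0,\infty)^d:\tau(s)=1\}$ of an admissible gauge $\tau$, and let $H_k$ be the angular measure of $F_k$ on $S$. Put $M_\infty:=\sup_{s\in S}\|s\|_\infty^\alpha$. (i) With $\Delta_V:=\sup_{u\in(0,\infty)^d,\ \min_j u_j=1}|V_1(u)-V_2(u)|$, $$\mathrm d_K(F_1,F_2)=\sup_{\substack{u\in(0,\infty)^d\\ \min_j u_j=1}}\omega\left(\frac{|V_1(u)-V_2(u)|}{V_1(u)\wedge V_2(u)}\right)\le\omega(\Delta_V)\le\frac{\Delta_V}{e}.$$ (ii) If $V_k(x)=\sum_{j=1}^d x_j^{-\alpha}\Psi_j^{(k)}(x)$ for all $x\in(0,\infty)^d$ and $k=1,2$, then $$\mathrm d_K(F_1,F_2)\le\omega(\Delta_\Psi)\le\frac{\Delta_\Psi}{e},\qquad \Delta_\Psi:=\sup_{\substack{x\in(0,\infty)^d\\ \min_j x_j=1}}\left|\sum_{j=1}^d x_j^{-\alpha}\bigl(\Psi_j^{(1)}(x)-\Psi_j^{(2)}(x)\bigr)\right|,$$ and in particular $$\Delta_\Psi\le\sup_{\substack{x\in(0,\infty)^d\\ \min_j x_j=1}}\sum_{j=1}^d\left|\Psi_j^{(1)}(x)-\Psi_j^{(2)}(x)\right|.$$ (iii)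 If $S=\{s\in[0,\infty)^d:\|s\|=1\}$ is a positive norm sphere and $\|x\|\ge A\|x\|_\infty$ for all $x\in[0,\infty)^d$ (with a constant $A>0$), then $M_\infty\le A^{-\alpha}$. In particular $M_\infty=1$ for $S=\{s\in[0,\infty)^d:\|s\|_p=1\}$, $1\le p\le\infty$. Moreover, with $M_\alpha:=\sup_{s\in S}\|s\|_\alpha^\alpha$, one has $M_\infty\le M_\alpha$, and hence $$\mathrm d_K(F_1,F_2)\le\frac{M_\alpha}{e}\|H_1-H_2\|_{\mathrm{TV}}.$$ (iv) On the positive $\ell_\alpha$-gauge sphere $S_\alpha=\{s\in[0,\infty)^d:\sum_{j=1}^d s_j^\alpha=1\}$ one has, for every $\alpha>0$, $$\sup_{s\in S_\alpha}\|s\|_\infty^\alpha=1.$$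
   Context: $a\wedge b=\min(a,b)$; $\|x\|_\infty=\max_j|x_j|$; $\|x\|_\alpha=(\sum_j|x_j|^\alpha)^{1/\alpha}$ for $0<\alpha<\infty$ (a gauge, not a norm, if $\alpha<1$). Kolmogorov distance: $\mathrm d_K(F_1,F_2)=\sup_{x\in\mathbb{R}^d}|F_1(x)-F_2(x)|$. The function $\omega:[0,\infty)\to[0,\infty)$ is $\omega(0)=0$ and $\omega(t)=\frac{t}{1+t}(1+t)^{-1/t}$ for $t>0$. A $d$-dimensional max-stable distribution function $F$ with unit-$\alpha$-Fréchet margins (each margin is $x\mapsto\exp\{-x^{-\alpha}\}$ for $x>0$) has the form $F(x)=\exp\{-V(x)\}$ for $x\in(0,\infty)^d$ (and $F(x)=0$ if some coordinate is non-positive), where the exponent function $V$ is $V(x)=\mathbb{E}\{\max_{1\le j\le d}Z_j^\alpha/x_j^\alpha\}$ for some random vector $Z$ with values in $[0,\infty)^d$ such that $\mathbb{E}\{Z_j^\alpha\}=1$ for all $j$ and $\mathbb{P}\{\max_jZ_j>0\}=1$ (a de Haan representer of $F$). Admissible gauge: a Borel-measurable $1$-homogeneous map $\tau:[0,\infty)^d\to[0,\infty)$ for which there are constants $0<a\le b<\infty$ with $a\|x\|_\infty\le\tau(x)\le b\|x\|_\infty$ for all $x\in[0,\infty)^d$. Angular measure: with $\tau$ the chosen norm or gauge defining $S$, the angular measure of $F$ on $S$ is the finite Borel measure $H(B)=\mathbb{E}\{\tau(Z)^\alpha\,\mathbb{I}(Z/\tau(Z)\in B)\}$, $B\in\mathcal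 B(S)$, for a de Haan representer $Z$ of $F$. It satisfies $\int_S s_j^\alpha H(ds)=1$ for all $j$ and $V(x)=\int_S\max_{1\le j\le d}(s_j/x_j)^\alpha H(ds)$. Total variation (setwise convention): $\|H_1-H_2\|_{\mathrm{TV}}=\sup_{A\in\mathcal B(S)}|H_1(A)-H_2(A)|$. *)

theory Defs
  imports "HOL-Probability.Probability"
begin

text \<open>
  Vectors in \<open>d\<close>-dimensional space are elements of \<^typ>\<open>real ^ 'd\<close> with \<open>d = CARD('d)\<close>,
  the maximum norm is \<^const>\<open>infnorm\<close>, and the order on vectors is componentwise.
  The real-valued suprema below are taken over nonempty sets that are bounded above in every
  situation in which the theorem uses them; a supremum that may be infinite is taken in
  \<^typ>\<open>ereal\<close> in the theorem itself.
\<close>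

definition nonneg_orthant :: "(real ^ 'd) set" where
  "nonneg_orthant = {x. \<forall>j. 0 \<le> x $ j}"

definition pos_orthant :: "(real ^ 'd) set" where
  "pos_orthant = {x. \<forall>j. 0 < x $ j}"

definition pos_min_one :: "(real ^ 'd) set" where
  "pos_min_one = {u \<in> pos_orthant. (MIN j. u $ j) = 1}"

definition lgauge :: "real \<Rightarrow> real ^ 'd \<Rightarrow> real" where
  "lgauge p x = (\<Sum>j\<in>UNIV. \<bar>x $ j\<bar> powr p) powr (1 / p)"

definition omega :: "real \<Rightarrow> real" where
  "omega t = (if t = 0 then 0 else t / (1 + t) * (1 + t) powr (- 1 / t))"

definition kolmogorov_dist :: "(real ^ 'd \<Rightarrow> real) \<Rightarrow> (real ^ 'd \<Rightarrow> real) \<Rightarrow> real" where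
  "kolmogorov_dist F G = (SUP x. \<bar>F x - G x\<bar>)"


section \<open>Max-stable distribution functions and de Haan representers\<close>

definition max_stable :: "(real ^ 'd \<Rightarrow> real) \<Rightarrow> bool" where
  "max_stable F \<longleftrightarrow>
     (\<forall>n\<ge>1. \<exists>a b :: real ^ 'd. (\<forall>j. 0 < a $ j) \<and>
        (\<forall>x. F (\<chi> j. a $ j * x $ j + b $ j) ^ n = F x))"

text \<open>The value \<open>0\<close> of the margins on \<open>(-\<infinity>, 0]\<close> follows from monotonicity.\<close>

definition max_stable_frechet :: "real \<Rightarrow> (real ^ 'd \<Rightarrow> real) \<Rightarrow> bool" where
  "max_stable_frechet \<alpha> F \<longleftrightarrow>
     (\<exists>P :: (real ^ 'd) measure. prob_space P \<and> sets P = sets borel \<and>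
        (\<forall>x. F x = measure P {..x}) \<and>
        (\<forall>j. \<forall>t>0. cdf (distr P borel (\<lambda>x. x $ j)) t = exp (- (t powr - \<alpha>)))) \<and>
     max_stable F"

definition exponent_function ::
    "real \<Rightarrow> 'a measure \<Rightarrow> ('a \<Rightarrow> real ^ 'd) \<Rightarrow> real ^ 'd \<Rightarrow> real" where
  "exponent_function \<alpha> M Z x = (\<integral>w. (MAX j. (Z w $ j) powr \<alpha> / (x $ j) powr \<alpha>) \<partial>M)"

definition de_haan_representer ::
    "real \<Rightarrow> 'a measure \<Rightarrow> ('a \<Rightarrow> real ^ 'd) \<Rightarrow> (real ^ 'd \<Rightarrow> real) \<Rightarrow> bool" where
  "de_haan_representer \<alpha> M Z F \<longleftrightarrow>
     prob_space M \<and> Z \<in> borel_measurable M \<and>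
     (\<forall>w \<in> space M. Z w \<in> nonneg_orthant) \<and>
     (\<forall>j. (\<integral>w. (Z w $ j) powr \<alpha> \<partial>M) = 1) \<and>
     (AE w in M. 0 < (MAX j. Z w $ j)) \<and>
     (\<forall>x. F x = (if x \<in> pos_orthant then exp (- exponent_function \<alpha> M Z x) else 0))"


section \<open>Norms, gauges, spheres and angular measures\<close>

definition is_norm :: "(real ^ 'd \<Rightarrow> real) \<Rightarrow> bool" where
  "is_norm N \<longleftrightarrow>
     (\<forall>x. 0 \<le> N x) \<and> (\<forall>x. N x = 0 \<longleftrightarrow> x = 0) \<and>
     (\<forall>c x. N (c *\<^sub>R x) = \<bar>c\<bar> * N x) \<and> (\<forall>x y. N (x + y) \<le> N x + N y)"

definition admissible_gauge :: "(real ^ 'd \<Rightarrow> real) \<Rightarrow> bool" where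
  "admissible_gauge \<tau> \<longleftrightarrow>
     \<tau> \<in> borel_measurable (restrict_space borel nonneg_orthant) \<and>
     (\<forall>x \<in> nonneg_orthant. 0 \<le> \<tau> x) \<and>
     (\<forall>c>0. \<forall>x \<in> nonneg_orthant. \<tau> (c *\<^sub>R x) = c * \<tau> x) \<and>
     (\<exists>a b. 0 < a \<and> a \<le> b \<and>
        (\<forall>x \<in> nonneg_orthant. a * infnorm x \<le> \<tau> x \<and> \<tau> x \<le> b * infnorm x))"

definition pos_sphere :: "(real ^ 'd \<Rightarrow> real) \<Rightarrow> (real ^ 'd) set" where
  "pos_sphere \<tau> = {s \<in> nonneg_orthant. \<tau> s = 1}"

definition is_angular_measure ::
    "real \<Rightarrow> (real ^ 'd \<Rightarrow> real) \<Rightarrow> 'a measure \<Rightarrow> ('a \<Rightarrow> real ^ 'd) \<Rightarrow> (real ^ 'd) measure \<Rightarrow> bool" where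
  "is_angular_measure \<alpha> \<tau> M Z H \<longleftrightarrow>
     finite_measure H \<and> sets H = sets (restrict_space borel (pos_sphere \<tau>)) \<and>
     (\<forall>B \<in> sets H. measure H B =
        (\<integral>w. \<tau> (Z w) powr \<alpha> * indicator B ((1 / \<tau> (Z w)) *\<^sub>R Z w) \<partial>M))"

definition tv_dist :: "'b :: topological_space set \<Rightarrow> 'b measure \<Rightarrow> 'b measure \<Rightarrow> real" where
  "tv_dist S H1 H2 = (SUP A \<in> sets (restrict_space borel S). \<bar>measure H1 A - measure H2 A\<bar>)"

definition M_infty :: "real \<Rightarrow> (real ^ 'd) set \<Rightarrow> real" where
  "M_infty \<alpha> S = (SUP s\<in>S. infnorm s powr \<alpha>)"

definition M_alpha :: "real \<Rightarrow> (real ^ 'd) set \<Rightarrow> real" where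
  "M_alpha \<alpha> S = (SUP s\<in>S. lgauge \<alpha> s powr \<alpha>)"

end

theory Submission
  imports Defs
begin

text \<open>
  The function \<open>\<omega>\<close> is a maximal exponential gap: \<open>\<omega>(t)\<close> is the maximum over \<open>r \<ge> 0\<close> of
  \<open>e\<^sup>-\<^sup>r - e\<^bsup>-r(1+t)\<^esup>\<close>, attained at \<open>r = ln (1 + t) / t\<close> for \<open>t > 0\<close> (\<open>exp_diff_le_omega\<close> and
  \<open>omega_attained\<close>). Monotonicity of \<open>\<omega>\<close> and the bound \<open>\<omega>(t) \<le> t / e\<close> follow from this description.

  An exponent function is homogeneous of order \<open>-\<alpha>\<close>, and every point of the open orthant is \<open>t u\<close> with
  \<open>t > 0\<close> and \<open>min\<^sub>j u\<^sub>j = 1\<close>. On the ray through \<open>u\<close> the difference of the two distribution functions is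
  \<open>e\<^bsup>-r V\<^sub>1(u)\<^esup> - e\<^bsup>-r V\<^sub>2(u)\<^esup>\<close> with \<open>r = t\<^bsup>-\<alpha>\<^esup>\<close> running through \<open>(0, \<infinity>)\<close>, so its largest absolute value is
  \<open>\<omega>(\<bar>V\<^sub>1(u) - V\<^sub>2(u)\<bar> / min (V\<^sub>1(u)) (V\<^sub>2(u)))\<close>; taking the supremum over \<open>u\<close> gives the formula for the
  Kolmogorov distance (\<open>kolmogorov_dist_homogeneous\<close>). The normalisation of the representer gives
  \<open>1 \<le> V\<^sub>k(u) \<le> d\<close> for such \<open>u\<close> (\<open>exponent_function_bounds\<close>): the lower bound allows the denominator to be
  dropped, and the upper bound makes the suprema finite. The statement on \<open>\<Psi>\<close> is the same bound for
  \<open>V\<^sub>1 - V\<^sub>2\<close> written as a sum, with weights \<open>x\<^sub>j\<^bsup>-\<alpha>\<^esup> \<le> 1\<close>.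

  For the total variation bound, \<open>V\<^sub>k(u)\<close> is the integral of \<open>g(s) = max\<^sub>j (s\<^sub>j / u\<^sub>j)\<^sup>\<alpha>\<close> against the angular
  measure, and \<open>0 \<le> g \<le> M\<^sub>\<infinity>\<close> on the sphere. By the layer-cake formula the two integrals differ by at
  most \<open>M\<^sub>\<infinity>\<close> times the setwise distance. Since the angular measure is given through its values on sets,
  the layer-cake formula is used in discretised form: \<open>n\<close> layers of height \<open>M\<^sub>\<infinity> / n\<close> recover \<open>g\<close> up to
  \<open>M\<^sub>\<infinity> / n\<close> (\<open>polar_integral_layers\<close>), and then \<open>n\<close> tends to infinity.
  The passage from \<open>M\<^sub>\<infinity>\<close> to \<open>M\<^sub>\<alpha>\<close> is the bound of a maximum of non-negative terms by their sum.
  A norm needs no separate treatment, because it is an admissible gauge (\<open>is_norm_imp_admissible_gauge\<close>).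
\<close>

section \<open>The function \<open>\<omega>\<close> as a maximal exponential gap\<close>

lemma omega_eq_exp:
  assumes "0 < t"
  shows "omega t = t / (1 + t) * exp (- (ln (1 + t) / t))"
  using assms by (simp add: omega_def powr_def)

text \<open>
  With \<open>p = 1 + t\<close> and the maximiser \<open>r\<^sub>0 = ln p / t\<close>, the substitution \<open>s = r\<^sub>0 - r\<close> reduces the claim to
  Bernoulli's inequality \<open>(e\<^sup>s)\<^sup>p \<ge> 1 + p (e\<^sup>s - 1)\<close>. This is Young's inequality for \<open>e\<^bsup>ps\<^esup>\<close> and \<open>1\<close>.
\<close>

lemma exp_diff_le_omega:
  assumes "0 \<le> t"
  shows "exp (- r) - exp (- (r * (1 + t))) \<le> omega t"
proof (cases "t = 0")
  case True
  then show ?thesis by (simp add: omega_def)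
next
  case False
  with assms have t: "0 < t" by simp
  define p where "p = 1 + t"
  define r0 where "r0 = ln p / t"
  define s where "s = r0 - r"
  have p: "1 < p" using t by (simp add: p_def)
  have "exp (p * s) powr (1 / p) * 1 powr (1 - 1 / p) \<le> (1 / p) * exp (p * s) + (1 - 1 / p) * 1"
    by (rule Youngs_inequality_0) (use p in auto)
  then have "exp s \<le> exp (p * s) / p + (1 - 1 / p)"
    using p by (simp add: exp_powr_real)
  then have "p * exp s \<le> p * (exp (p * s) / p + (1 - 1 / p))"
    using p by (intro mult_left_mono) auto
  also have "\<dots> = exp (p * s) + p - 1" using p by (simp add: field_simps)
  finally have bern: "p * exp s \<le> exp (p * s) + p - 1" .
  have r0p: "exp (- (r0 * p)) = exp (- r0) / p"
  proof -
    have "r0 * p = r0 + ln p" using t by (simp add: r0_def p_def field_simps)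
    then show ?thesis using p by (simp add: exp_add exp_diff exp_minus field_simps)
  qed
  have e1: "exp (- r) = exp (- r0) * exp s" by (simp add: s_def exp_add[symmetric])
  have "exp (- (r * p)) = exp (- (r0 * p)) * exp (p * s)"
    by (simp add: s_def exp_add[symmetric] algebra_simps)
  also have "\<dots> \<ge> exp (- (r0 * p)) * (p * exp s - p + 1)"
    by (rule mult_left_mono) (use bern in auto)
  finally have "exp (- (r0 * p)) * (p * exp s - p + 1) \<le> exp (- (r * p))" .
  moreover have "exp (- (r0 * p)) * (p * exp s - p + 1) = exp (- r) - exp (- r0) * (t / p)"
    unfolding r0p e1 using p by (simp add: p_def field_simps)
  ultimately have "exp (- r) - exp (- (r * p)) \<le> t / p * exp (- r0)" by (simp add: mult.commute)
  then show ?thesis unfolding omega_eq_exp[OF t] r0_def p_def by simp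
qed

lemma omega_attained:
  assumes "0 < t"
  obtains r where "0 < r" and "omega t = exp (- r) - exp (- (r * (1 + t)))"
proof
  show "0 < ln (1 + t) / t" using assms by simp
  have "ln (1 + t) / t * (1 + t) = ln (1 + t) / t + ln (1 + t)"
    using assms by (simp add: field_simps)
  then have "exp (- (ln (1 + t) / t * (1 + t))) = exp (- (ln (1 + t) / t)) * exp (- ln (1 + t))"
    by (simp add: exp_add[symmetric])
  also have "exp (- ln (1 + t)) = 1 / (1 + t)" using assms by (simp add: exp_minus inverse_eq_divide)
  finally show "omega t = exp (- (ln (1 + t) / t)) - exp (- (ln (1 + t) / t * (1 + t)))"
    unfolding omega_eq_exp[OF assms] using assms by (simp add: field_simps)
qed

lemma omega_nonneg: "0 \<le> t \<Longrightarrow> 0 \<le> omega t"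
  by (simp add: omega_def)

lemma omega_mono:
  assumes "0 \<le> s" "s \<le> t"
  shows "omega s \<le> omega t"
proof (cases "s = 0")
  case True
  then show ?thesis using assms omega_nonneg[of t] by (simp add: omega_def)
next
  case False
  with assms have "0 < s" by simp
  then obtain r where r: "0 < r" "omega s = exp (- r) - exp (- (r * (1 + s)))"
    by (rule omega_attained)
  have "exp (- (r * (1 + t))) \<le> exp (- (r * (1 + s)))" using r(1) assms(2) by simp
  then have "omega s \<le> exp (- r) - exp (- (r * (1 + t)))" using r(2) by simp
  also have "\<dots> \<le> omega t" by (rule exp_diff_le_omega) (use assms in simp)
  finally show ?thesis .
qed

lemma omega_le:
  assumes "0 \<le> t"
  shows "omega t \<le> t / exp 1"
proof (cases "t = 0")
  case True
  then show ?thesis by (simp add: omega_def)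
next
  case False
  with assms have "0 < t" by simp
  then obtain r where r: "0 < r" "omega t = exp (- r) - exp (- (r * (1 + t)))"
    by (rule omega_attained)
  have "exp (- (r * (1 + t))) = exp (- r) * exp (- (r * t))"
    by (simp add: exp_add[symmetric] algebra_simps)
  then have "omega t = exp (- r) * (1 - exp (- (r * t)))" using r(2) by (simp add: algebra_simps)
  also have "\<dots> \<le> exp (- r) * (r * t)"
    using exp_ge_add_one_self[of "- (r * t)"] by (intro mult_left_mono) auto
  also have "\<dots> = (r * exp (- r)) * t" by simp
  also have "\<dots> \<le> exp (- 1) * t"
  proof (rule mult_right_mono)
    have "r \<le> exp (r - 1)" using exp_ge_add_one_self[of "r - 1"] by simp
    then have "r * exp (- r) \<le> exp (r - 1) * exp (- r)" by (rule mult_right_mono) simp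
    also have "\<dots> = exp (- 1)" by (simp add: exp_add[symmetric])
    finally show "r * exp (- r) \<le> exp (- 1)" .
  qed (use assms in simp)
  finally show ?thesis by (simp add: exp_minus field_simps)
qed

lemma abs_exp_diff_le_omega:
  assumes "0 < a" "0 < b" "0 \<le> r"
  shows "\<bar>exp (- (r * a)) - exp (- (r * b))\<bar> \<le> omega (\<bar>a - b\<bar> / min a b)"
  using assms
proof (induction a b rule: linorder_wlog)
  case (le a b)
  have arg: "\<bar>a - b\<bar> / min a b = (b - a) / a" and rb: "r * a * (1 + (b - a) / a) = r * b"
    using le by (auto simp: field_simps)
  have "exp (- (r * a)) - exp (- (r * b)) \<le> omega ((b - a) / a)"
    using exp_diff_le_omega[of "(b - a) / a" "r * a"] le unfolding rb by simp
  moreover have "r * a \<le> r * b" using le by (intro mult_left_mono) auto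
  ultimately show ?case unfolding arg by simp
next
  case (sym a b)
  then show ?case by (simp add: abs_minus_commute min.commute)
qed

lemma abs_exp_diff_eq_omega:
  assumes "0 < a" "0 < b"
  shows "\<exists>r>0. \<bar>exp (- (r * a)) - exp (- (r * b))\<bar> = omega (\<bar>a - b\<bar> / min a b)"
  using assms
proof (induction a b rule: linorder_wlog)
  case (le a b)
  show ?case
  proof (cases "a = b")
    case True
    then show ?thesis by (auto simp: omega_def intro: exI[of _ 1])
  next
    case False
    with le have "0 < (b - a) / a" by simp
    then obtain r where r: "0 < r"
      "omega ((b - a) / a) = exp (- r) - exp (- (r * (1 + (b - a) / a)))"
      by (rule omega_attained)
    have arg: "\<bar>a - b\<bar> / min a b = (b - a) / a" and ra: "r / a * a = r"
      and rb: "r / a * b = r * (1 + (b - a) / a)"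
      using le by (auto simp: field_simps)
    have "0 \<le> omega ((b - a) / a)" using le by (intro omega_nonneg) simp
    then have "\<bar>exp (- (r / a * a)) - exp (- (r / a * b))\<bar> = omega (\<bar>a - b\<bar> / min a b)"
      unfolding arg ra rb r(2) by simp
    moreover have "0 < r / a" using r le by simp
    ultimately show ?thesis by blast
  qed
next
  case (sym a b)
  then show ?case by (simp add: abs_minus_commute min.commute)
qed

section \<open>The orthants and the maximum norm\<close>

lemma pos_min_one_iff:
  "x \<in> pos_min_one \<longleftrightarrow> (\<forall>j. 1 \<le> x $ j) \<and> (\<exists>j. x $ j = 1)"
proof
  assume x: "x \<in> pos_min_one"
  then have m: "Min (range (($) x)) = 1" by (simp add: pos_min_one_def)
  have "Min (range (($) x)) \<in> range (($) x)" by (rule Min_in) auto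
  moreover have "1 \<le> x $ j" for j unfolding m[symmetric] by (rule Min_le) auto
  ultimately show "(\<forall>j. 1 \<le> x $ j) \<and> (\<exists>j. x $ j = 1)" unfolding m by (metis imageE)
next
  assume x: "(\<forall>j. 1 \<le> x $ j) \<and> (\<exists>j. x $ j = 1)"
  then have "Min (range (($) x)) = 1" by (intro Min_eqI) (auto simp: image_iff dest: sym)
  moreover have "0 < x $ j" for j using x by (metis less_le_trans zero_less_one)
  ultimately show "x \<in> pos_min_one" by (simp add: pos_min_one_def pos_orthant_def)
qed

lemma pos_min_one_nonempty: "pos_min_one \<noteq> {}"
proof -
  have "1 \<in> pos_min_one" by (simp add: pos_min_one_iff)
  then show ?thesis by blast
qed

lemma pos_min_one_subset: "x \<in> pos_min_one \<Longrightarrow> x \<in> pos_orthant"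
  by (simp add: pos_min_one_def)

lemma pos_orthant_scaled:
  assumes "x \<in> pos_orthant"
  obtains t u where "0 < t" "u \<in> pos_min_one" "x = t *\<^sub>R u"
proof -
  define t where "t = Min (range (($) x))"
  have "t \<in> range (($) x)" unfolding t_def by (rule Min_in) auto
  then obtain j where j: "t = x $ j" by blast
  have t: "0 < t" using assms j by (simp add: pos_orthant_def)
  have le: "t \<le> x $ i" for i unfolding t_def by (rule Min_le) auto
  have "(1 / t) *\<^sub>R x \<in> pos_min_one"
    using t le j by (auto simp: pos_min_one_iff intro: exI[of _ j])
  moreover have "x = t *\<^sub>R ((1 / t) *\<^sub>R x)" using t by simp
  ultimately show ?thesis using that t by blast
qed

lemma infnorm_attained: "\<exists>j. infnorm (x :: real ^ 'd) = \<bar>x $ j\<bar>"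
proof -
  have eq: "{\<bar>x $ i\<bar> |i. i \<in> UNIV} = range (\<lambda>i. \<bar>x $ i\<bar>)" by auto
  have "infnorm x = Max (range (\<lambda>i. \<bar>x $ i\<bar>))"
    unfolding infnorm_cart eq by (rule cSup_eq_Max) auto
  moreover have "Max (range (\<lambda>i. \<bar>x $ i\<bar>)) \<in> range (\<lambda>i. \<bar>x $ i\<bar>)" by (rule Max_in) auto
  ultimately show ?thesis by (metis imageE)
qed

lemma nonneg_orthant_axis: "axis j 1 \<in> nonneg_orthant"
  by (simp add: nonneg_orthant_def axis_def)

lemma infnorm_axis: "infnorm (axis j 1 :: real ^ 'd) = 1"
proof (rule antisym)
  show "infnorm (axis j 1 :: real ^ 'd) \<le> 1"
    using infnorm_attained[of "axis j 1 :: real ^ 'd"] by (auto simp: axis_def)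
  show "1 \<le> infnorm (axis j 1 :: real ^ 'd)"
    using component_le_infnorm_cart[of "axis j 1 :: real ^ 'd" j] by (simp add: axis_def)
qed

lemma nonneg_orthant_scale: "0 \<le> c \<Longrightarrow> x \<in> nonneg_orthant \<Longrightarrow> c *\<^sub>R x \<in> nonneg_orthant"
  by (simp add: nonneg_orthant_def)

lemma closed_nonneg_orthant: "closed (nonneg_orthant :: (real ^ 'd) set)"
  unfolding nonneg_orthant_def by (intro closed_Collect_all closed_Collect_le continuous_intros)

section \<open>Norms, gauges and their spheres\<close>

text \<open>
  All norms on a finite-dimensional space are equivalent: a norm is bounded by a multiple of the maximum
  norm, hence Lipschitz continuous, and so attains a positive minimum on the compact Euclidean sphere.
\<close>

lemma is_norm_imp_admissible_gauge:
  fixes N :: "real ^ 'd \<Rightarrow> real"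
  assumes "is_norm N"
  shows "admissible_gauge N"
proof -
  have nn: "0 \<le> N x" and zero: "N x = 0 \<longleftrightarrow> x = 0" and hom: "N (c *\<^sub>R x) = \<bar>c\<bar> * N x"
    and tri: "N (x + y) \<le> N x + N y" for c x y
    using assms by (auto simp: is_norm_def)
  have sum_le: "N (sum f A) \<le> (\<Sum>i\<in>A. N (f i))" if "finite A" for f and A :: "'d set"
    using that
  proof induction
    case empty
    then show ?case using zero[of 0] by simp
  next
    case (insert i A)
    then show ?case using tri[of "f i" "sum f A"] by simp
  qed
  define C where "C = (\<Sum>j\<in>UNIV. N (axis j 1))"
  have C0: "0 \<le> C" unfolding C_def by (intro sum_nonneg nn)
  have upper: "N x \<le> C * infnorm x" for x
  proof -
    have "N x = N (\<Sum>j\<in>UNIV. x $ j *\<^sub>R axis j 1)"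
      using basis_expansion[of x] by (simp add: scalar_mult_eq_scaleR)
    also have "\<dots> \<le> (\<Sum>j\<in>UNIV. N (x $ j *\<^sub>R axis j 1))" by (rule sum_le) simp
    also have "\<dots> \<le> (\<Sum>j\<in>UNIV. infnorm x * N (axis j 1))"
      unfolding hom by (intro sum_mono mult_right_mono component_le_infnorm_cart nn)
    finally show ?thesis by (simp add: C_def sum_distrib_left mult.commute)
  qed
  have diff: "\<bar>N x - N y\<bar> \<le> C * norm (x - y)" for x y
  proof -
    have "N x \<le> N (x - y) + N y" "N y \<le> N (y - x) + N x"
      using tri[of "x - y" y] tri[of "y - x" x] by simp_all
    moreover have "N (y - x) = N (x - y)" using hom[of "-1" "x - y"] by simp
    moreover have "N (x - y) \<le> C * norm (x - y)"
      using upper[of "x - y"] mult_left_mono[OF infnorm_le_norm C0, of "x - y"] by linarith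
    ultimately show ?thesis by linarith
  qed
  have "C-lipschitz_on UNIV N"
    by (rule lipschitz_onI) (auto simp: dist_norm diff C0)
  then have cont: "continuous_on A N" for A
    using lipschitz_on_continuous_on continuous_on_subset by blast
  obtain x0 where x0: "x0 \<in> sphere (0 :: real ^ 'd) 1" "\<And>y. y \<in> sphere 0 1 \<Longrightarrow> N x0 \<le> N y"
  proof -
    have "axis undefined 1 \<in> sphere (0 :: real ^ 'd) 1" by simp
    then have "sphere (0 :: real ^ 'd) 1 \<noteq> {}" by blast
    from continuous_attains_inf[OF compact_sphere this cont] show ?thesis using that by blast
  qed
  have pos: "0 < N x0"
  proof -
    have "x0 \<noteq> 0" using x0(1) by auto
    then show ?thesis using nn[of x0] zero[of x0] by linarith
  qed
  have lower: "N x0 * infnorm x \<le> N x" for x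
  proof (cases "x = 0")
    case True
    then show ?thesis by (simp add: infnorm_0 nn)
  next
    case False
    then have "N x0 \<le> N ((1 / norm x) *\<^sub>R x)" by (intro x0(2)) simp
    also have "\<dots> = N x / norm x" unfolding hom by simp
    finally have "N x0 * norm x \<le> N x" using False by (simp add: field_simps)
    moreover have "N x0 * infnorm x \<le> N x0 * norm x"
      using pos by (intro mult_left_mono infnorm_le_norm) auto
    ultimately show ?thesis by linarith
  qed
  have "N \<in> borel_measurable borel" by (rule borel_measurable_continuous_onI[OF cont])
  then have "N \<in> borel_measurable (restrict_space borel nonneg_orthant)"
    by (rule measurable_restrict_space1)
  \<comment> \<open>The upper constant is enlarged from \<open>C\<close> to \<open>C + N x0\<close> so that it dominates the lower one.\<close>
  moreover have "N x0 \<le> C + N x0" using C0 by simp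
  moreover have "N x \<le> (C + N x0) * infnorm x" for x
    using upper[of x] mult_nonneg_nonneg[OF less_imp_le[OF pos] infnorm_pos_le[of x]]
    by (simp add: algebra_simps)
  ultimately show ?thesis
    unfolding admissible_gauge_def using nn hom pos lower
    by (intro conjI exI[of _ "N x0"] exI[of _ "C + N x0"]) auto
qed

lemma admissible_gaugeE:
  assumes "admissible_gauge \<tau>"
  obtains a b where "0 < a" "a \<le> b"
    "\<And>x. x \<in> nonneg_orthant \<Longrightarrow> a * infnorm x \<le> \<tau> x"
    "\<And>x. x \<in> nonneg_orthant \<Longrightarrow> \<tau> x \<le> b * infnorm x"
  using assms unfolding admissible_gauge_def by blast

lemma admissible_gauge_eq_0_iff:
  assumes "admissible_gauge \<tau>" "x \<in> nonneg_orthant"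
  shows "\<tau> x = 0 \<longleftrightarrow> x = 0"
proof -
  obtain a b where ab: "0 < a" "a \<le> b" "a * infnorm x \<le> \<tau> x" "\<tau> x \<le> b * infnorm x"
    using admissible_gaugeE[OF assms(1)] assms(2) by metis
  show ?thesis
  proof
    assume "\<tau> x = 0"
    then have "infnorm x \<le> 0" using ab(1,3) by (simp add: mult_le_0_iff)
    then show "x = 0" using infnorm_pos_lt[of x] by linarith
  next
    assume "x = 0"
    then show "\<tau> x = 0" using ab by (simp add: infnorm_0)
  qed
qed

lemma admissible_gauge_normalized:
  assumes "admissible_gauge \<tau>" "x \<in> nonneg_orthant" "x \<noteq> 0"
  shows "0 < \<tau> x" "(1 / \<tau> x) *\<^sub>R x \<in> pos_sphere \<tau>"
proof -
  have "0 \<le> \<tau> x" and hom: "\<And>c. 0 < c \<Longrightarrow> \<tau> (c *\<^sub>R x) = c * \<tau> x"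
    using assms by (auto simp: admissible_gauge_def)
  then show p: "0 < \<tau> x" using admissible_gauge_eq_0_iff[OF assms(1,2)] assms(3) by linarith
  then show "(1 / \<tau> x) *\<^sub>R x \<in> pos_sphere \<tau>"
    using hom[of "1 / \<tau> x"] assms(2) by (simp add: pos_sphere_def nonneg_orthant_scale)
qed

lemma pos_sphere_nonempty:
  fixes \<tau> :: "real ^ 'd \<Rightarrow> real"
  assumes "admissible_gauge \<tau>"
  shows "pos_sphere \<tau> \<noteq> {}"
proof -
  have "axis undefined 1 \<noteq> (0 :: real ^ 'd)" by simp
  from admissible_gauge_normalized(2)[OF assms nonneg_orthant_axis this] show ?thesis by blast
qed

lemma pos_sphere_sets:
  assumes "admissible_gauge \<tau>"
  shows "pos_sphere \<tau> \<in> sets borel"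
proof -
  have cl: "nonneg_orthant \<in> sets borel" by (rule borel_closed[OF closed_nonneg_orthant])
  have "\<tau> -` {1} \<inter> space (restrict_space borel nonneg_orthant) \<in> sets (restrict_space borel nonneg_orthant)"
    using assms by (intro measurable_sets[of _ _ borel]) (auto simp: admissible_gauge_def)
  moreover have "\<tau> -` {1} \<inter> space (restrict_space borel nonneg_orthant) = pos_sphere \<tau>"
    by (auto simp: pos_sphere_def space_restrict_space)
  ultimately show ?thesis using cl by (auto simp: sets_restrict_space)
qed

section \<open>The constants \<open>M\<^sub>\<infinity>\<close> and \<open>M\<^sub>\<alpha>\<close>\<close>

lemma lgauge_powr:
  assumes "0 < \<alpha>"
  shows "lgauge \<alpha> x powr \<alpha> = (\<Sum>j\<in>UNIV. \<bar>x $ j\<bar> powr \<alpha>)"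
  using assms by (simp add: lgauge_def powr_powr sum_nonneg)

lemma infnorm_powr_le_lgauge:
  assumes "0 < \<alpha>"
  shows "infnorm (x :: real ^ 'd) powr \<alpha> \<le> lgauge \<alpha> x powr \<alpha>"
proof -
  obtain j where j: "infnorm x = \<bar>x $ j\<bar>" using infnorm_attained by blast
  show ?thesis unfolding lgauge_powr[OF assms] j by (rule member_le_sum) auto
qed

lemma lgauge_axis: "0 < p \<Longrightarrow> lgauge p (axis j 1 :: real ^ 'd) = 1"
  by (simp add: lgauge_def axis_def if_distrib[of abs] if_distrib[of "\<lambda>y. y powr p"] cong: if_cong)

lemma M_infty_eq_1:
  fixes S :: "(real ^ 'd) set"
  assumes "0 < \<alpha>" "axis j 1 \<in> S" and le: "\<And>s. s \<in> S \<Longrightarrow> infnorm s \<le> 1"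
  shows "M_infty \<alpha> S = 1"
  unfolding M_infty_def
proof (rule cSup_eq_maximum)
  show "1 \<in> (\<lambda>s. infnorm s powr \<alpha>) ` S"
    using assms(2) by (intro image_eqI[of _ _ "axis j 1"]) (simp_all add: infnorm_axis)
  fix y assume "y \<in> (\<lambda>s. infnorm s powr \<alpha>) ` S"
  then obtain s where s: "s \<in> S" "y = infnorm s powr \<alpha>" by blast
  have "infnorm s powr \<alpha> \<le> 1 powr \<alpha>"
    using assms(1) le[OF s(1)] by (intro powr_mono2) (auto simp: infnorm_pos_le)
  then show "y \<le> 1" by (simp add: s)
qed

lemma M_infty_lgauge_sphere:
  assumes "0 < \<alpha>" "0 < p"
  shows "M_infty \<alpha> (pos_sphere (lgauge p) :: (real ^ 'd) set) = 1"
proof (rule M_infty_eq_1[OF assms(1)])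
  show "axis undefined 1 \<in> (pos_sphere (lgauge p) :: (real ^ 'd) set)"
    using assms by (simp add: pos_sphere_def nonneg_orthant_axis lgauge_axis)
  fix s :: "real ^ 'd" assume "s \<in> pos_sphere (lgauge p)"
  then have "infnorm s powr p \<le> 1"
    using infnorm_powr_le_lgauge[OF assms(2), of s] by (simp add: pos_sphere_def)
  then show "infnorm s \<le> 1"
    using powr_less_mono2[OF assms(2), of 1 "infnorm s"] by fastforce
qed

lemma M_infty_infnorm_sphere:
  assumes "0 < \<alpha>"
  shows "M_infty \<alpha> (pos_sphere infnorm :: (real ^ 'd) set) = 1"
  by (rule M_infty_eq_1[OF assms, of undefined])
     (auto simp: pos_sphere_def nonneg_orthant_axis infnorm_axis)

lemma pos_sphere_lgauge:
  assumes "0 < \<alpha>"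
  shows "pos_sphere (lgauge \<alpha>) = {s \<in> nonneg_orthant. (\<Sum>j\<in>UNIV. (s $ j) powr \<alpha>) = 1}"
proof -
  have "lgauge \<alpha> s = 1 \<longleftrightarrow> (\<Sum>j\<in>UNIV. (s $ j) powr \<alpha>) = 1" if "s \<in> nonneg_orthant" for s :: "real ^ 'd"
  proof -
    have "\<bar>s $ j\<bar> = s $ j" for j using that by (simp add: nonneg_orthant_def)
    then have eq: "lgauge \<alpha> s = (\<Sum>j\<in>UNIV. (s $ j) powr \<alpha>) powr (1 / \<alpha>)" by (simp add: lgauge_def)
    show ?thesis
      using lgauge_powr[OF assms, of s] \<open>\<And>j. \<bar>s $ j\<bar> = s $ j\<close> by (auto simp: eq)
  qed
  then show ?thesis by (auto simp: pos_sphere_def)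
qed

lemma infnorm_powr_le_of_lower_bound:
  assumes "0 < \<alpha>" "0 < a" "a * infnorm s \<le> 1"
  shows "infnorm s powr \<alpha> \<le> a powr - \<alpha>"
proof -
  have "infnorm s powr \<alpha> \<le> (1 / a) powr \<alpha>"
    using assms by (intro powr_mono2) (auto simp: infnorm_pos_le field_simps)
  also have "\<dots> = a powr - \<alpha>" using assms by (simp add: powr_minus powr_divide inverse_eq_divide)
  finally show ?thesis .
qed

lemma M_infty_le:
  assumes "0 < \<alpha>" "0 < A" "S \<noteq> {}" "\<And>s. s \<in> S \<Longrightarrow> A * infnorm s \<le> 1"
  shows "M_infty \<alpha> S \<le> A powr - \<alpha>"
  unfolding M_infty_def
  by (rule cSUP_least) (use assms infnorm_powr_le_of_lower_bound in auto)

lemma bdd_above_lgauge_pos_sphere: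
  fixes \<tau> :: "real ^ 'd \<Rightarrow> real"
  assumes "0 < \<alpha>" "admissible_gauge \<tau>"
  shows "bdd_above ((\<lambda>s. lgauge \<alpha> s powr \<alpha>) ` pos_sphere \<tau>)"
proof -
  obtain a where a: "0 < a" "\<And>x. x \<in> nonneg_orthant \<Longrightarrow> a * infnorm x \<le> \<tau> x"
    using admissible_gaugeE[OF assms(2)] by metis
  have "lgauge \<alpha> s powr \<alpha> \<le> (\<Sum>j\<in>(UNIV :: 'd set). a powr - \<alpha>)" if "s \<in> pos_sphere \<tau>" for s
    unfolding lgauge_powr[OF assms(1)]
  proof (rule sum_mono)
    fix j
    have "\<bar>s $ j\<bar> powr \<alpha> \<le> infnorm s powr \<alpha>"
      using assms(1) component_le_infnorm_cart[of s j] by (intro powr_mono2) auto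
    also have "\<dots> \<le> a powr - \<alpha>"
      by (rule infnorm_powr_le_of_lower_bound)
         (use assms a(1) a(2)[of s] that in \<open>auto simp: pos_sphere_def\<close>)
    finally show "\<bar>s $ j\<bar> powr \<alpha> \<le> a powr - \<alpha>" .
  qed
  then show ?thesis by (intro bdd_aboveI2)
qed

lemma M_infty_le_M_alpha:
  assumes "0 < \<alpha>" "admissible_gauge \<tau>"
  shows "M_infty \<alpha> (pos_sphere \<tau>) \<le> M_alpha \<alpha> (pos_sphere \<tau>)"
  unfolding M_infty_def M_alpha_def
  by (rule cSUP_mono[OF pos_sphere_nonempty[OF assms(2)] bdd_above_lgauge_pos_sphere[OF assms]])
     (use infnorm_powr_le_lgauge[OF assms(1)] in blast)

section \<open>Exponent functions\<close>

lemma Max_range_mult: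
  fixes f :: "'d :: finite \<Rightarrow> real"
  assumes "0 \<le> c"
  shows "(MAX j. c * f j) = c * (MAX j. f j)"
proof -
  have "mono (\<lambda>y. c * y)" using assms by (intro monoI mult_left_mono)
  then have "c * Max (range f) = Max ((\<lambda>y. c * y) ` range f)" by (intro mono_Max_commute) auto
  then show ?thesis by (simp add: image_image)
qed

lemma Max_range_nonneg:
  fixes f :: "'d :: finite \<Rightarrow> real"
  assumes "\<And>j. 0 \<le> f j"
  shows "0 \<le> (MAX j. f j)"
  using assms Max_ge[of "range f" "f undefined"] by (metis finite finite_imageI order_trans rangeI)

lemma Max_range_le_sum:
  fixes f :: "'d :: finite \<Rightarrow> real"
  assumes "\<And>j. 0 \<le> f j"
  shows "(MAX j. f j) \<le> (\<Sum>j\<in>UNIV. f j)"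
  using assms by (auto intro!: member_le_sum)

lemma de_haan_representerD:
  assumes "de_haan_representer \<alpha> M Z F"
  shows "prob_space M" "Z \<in> borel_measurable M" "\<And>w. w \<in> space M \<Longrightarrow> Z w \<in> nonneg_orthant"
    "(\<integral>w. (Z w $ j) powr \<alpha> \<partial>M) = 1"
    "F x = (if x \<in> pos_orthant then exp (- exponent_function \<alpha> M Z x) else 0)"
  using assms by (auto simp: de_haan_representer_def)

text \<open>
  The Bochner integral of a non-integrable function is \<open>0\<close>, so the moment condition
  \<open>E Z\<^sub>j\<^sup>\<alpha> = 1\<close> already contains integrability.
\<close>

lemma integrable_representer_component:
  assumes "de_haan_representer \<alpha> M Z F"
  shows "integrable M (\<lambda>w. (Z w $ j) powr \<alpha>)"
  using de_haan_representerD(4)[OF assms, of j] not_integrable_integral_eq by fastforce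

lemma integrable_representer_Max:
  fixes x :: "real ^ 'd"
  assumes R: "de_haan_representer \<alpha> M Z F"
  shows "integrable M (\<lambda>w. MAX j. (Z w $ j) powr \<alpha> / (x $ j) powr \<alpha>)"
proof (rule Bochner_Integration.integrable_bound)
  show "integrable M (\<lambda>w. \<Sum>j\<in>UNIV. (Z w $ j) powr \<alpha> / (x $ j) powr \<alpha>)"
    by (intro Bochner_Integration.integrable_sum integrable_divide integrable_representer_component[OF R])
  have [measurable]: "(\<lambda>w. (Z w $ j) powr \<alpha>) \<in> borel_measurable M" for j
    using integrable_representer_component[OF R] by (rule borel_measurable_integrable)
  show "(\<lambda>w. MAX j. (Z w $ j) powr \<alpha> / (x $ j) powr \<alpha>) \<in> borel_measurable M"
    by measurable
  have "norm (MAX j. (Z w $ j) powr \<alpha> / (x $ j) powr \<alpha>) \<le> norm (\<Sum>j\<in>UNIV. (Z w $ j) powr \<alpha> / (x $ j) powr \<alpha>)" for w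
  proof -
    have "0 \<le> (MAX j. (Z w $ j) powr \<alpha> / (x $ j) powr \<alpha>)" by (rule Max_range_nonneg) simp
    moreover have "(MAX j. (Z w $ j) powr \<alpha> / (x $ j) powr \<alpha>) \<le> (\<Sum>j\<in>UNIV. (Z w $ j) powr \<alpha> / (x $ j) powr \<alpha>)"
      by (rule Max_range_le_sum) simp
    ultimately show ?thesis unfolding real_norm_def by linarith
  qed
  then show "AE w in M. norm (MAX j. (Z w $ j) powr \<alpha> / (x $ j) powr \<alpha>)
      \<le> norm (\<Sum>j\<in>UNIV. (Z w $ j) powr \<alpha> / (x $ j) powr \<alpha>)" by simp
qed

lemma exponent_function_scale:
  fixes u :: "real ^ 'd"
  assumes "0 < t" "u \<in> pos_orthant"
  shows "exponent_function \<alpha> M Z (t *\<^sub>R u) = t powr - \<alpha> * exponent_function \<alpha> M Z u"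
proof -
  have eq: "(MAX j. (Z w $ j) powr \<alpha> / ((t *\<^sub>R u) $ j) powr \<alpha>)
      = t powr - \<alpha> * (MAX j. (Z w $ j) powr \<alpha> / (u $ j) powr \<alpha>)" for w
  proof -
    have "(Z w $ j) powr \<alpha> / ((t *\<^sub>R u) $ j) powr \<alpha> = t powr - \<alpha> * ((Z w $ j) powr \<alpha> / (u $ j) powr \<alpha>)" for j
    proof -
      have "0 < u $ j" using assms(2) by (simp add: pos_orthant_def)
      then show ?thesis using assms(1) by (simp add: powr_mult powr_minus field_simps)
    qed
    then show ?thesis by (simp only: Max_range_mult[OF powr_ge_zero])
  qed
  show ?thesis unfolding exponent_function_def eq by simp
qed

lemma exponent_function_bounds:
  fixes u :: "real ^ 'd"
  assumes R: "de_haan_representer \<alpha> M Z F" and "0 < \<alpha>" "u \<in> pos_min_one"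
  shows "1 \<le> exponent_function \<alpha> M Z u" "exponent_function \<alpha> M Z u \<le> CARD('d)"
proof -
  obtain i where i: "u $ i = 1" and u: "\<And>j. 1 \<le> u $ j" using assms(3) by (auto simp: pos_min_one_iff)
  have "(\<integral>w. (Z w $ i) powr \<alpha> \<partial>M) \<le> exponent_function \<alpha> M Z u"
    unfolding exponent_function_def
  proof (rule integral_mono[OF integrable_representer_component[OF R] integrable_representer_Max[OF R]])
    fix w
    have "(Z w $ i) powr \<alpha> / (u $ i) powr \<alpha> \<le> (MAX j. (Z w $ j) powr \<alpha> / (u $ j) powr \<alpha>)"
      by (rule Max_ge) auto
    then show "(Z w $ i) powr \<alpha> \<le> (MAX j. (Z w $ j) powr \<alpha> / (u $ j) powr \<alpha>)" by (simp add: i)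
  qed
  then show "1 \<le> exponent_function \<alpha> M Z u" by (simp add: de_haan_representerD(4)[OF R])
  have "exponent_function \<alpha> M Z u \<le> (\<integral>w. (\<Sum>j\<in>UNIV. (Z w $ j) powr \<alpha>) \<partial>M)"
    unfolding exponent_function_def
  proof (rule integral_mono[OF integrable_representer_Max[OF R]])
    show "integrable M (\<lambda>w. \<Sum>j\<in>UNIV. (Z w $ j) powr \<alpha>)"
      by (intro Bochner_Integration.integrable_sum integrable_representer_component[OF R])
    fix w
    have "(MAX j. (Z w $ j) powr \<alpha> / (u $ j) powr \<alpha>) \<le> (\<Sum>j\<in>UNIV. (Z w $ j) powr \<alpha> / (u $ j) powr \<alpha>)"
      by (rule Max_range_le_sum) simp
    also have "\<dots> \<le> (\<Sum>j\<in>UNIV. (Z w $ j) powr \<alpha>)"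
    proof (rule sum_mono)
      fix j
      have "1 \<le> (u $ j) powr \<alpha>" using u[of j] assms(2) by (simp add: ge_one_powr_ge_zero)
      then show "(Z w $ j) powr \<alpha> / (u $ j) powr \<alpha> \<le> (Z w $ j) powr \<alpha>"
        by (simp add: divide_le_eq mult_left_le_one_le mult_le_cancel_left1)
    qed
    finally show "(MAX j. (Z w $ j) powr \<alpha> / (u $ j) powr \<alpha>) \<le> (\<Sum>j\<in>UNIV. (Z w $ j) powr \<alpha>)" .
  qed
  also have "\<dots> = CARD('d)"
    by (simp add: Bochner_Integration.integral_sum integrable_representer_component[OF R] de_haan_representerD(4)[OF R])
  finally show "exponent_function \<alpha> M Z u \<le> CARD('d)" .
qed

section \<open>The Kolmogorov distance of distribution functions with homogeneous exponents\<close>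

lemma kolmogorov_dist_homogeneous:
  fixes F1 F2 V1 V2 :: "real ^ 'd \<Rightarrow> real"
  assumes \<alpha>: "0 < \<alpha>"
    and F1: "\<And>x. F1 x = (if x \<in> pos_orthant then exp (- V1 x) else 0)"
    and F2: "\<And>x. F2 x = (if x \<in> pos_orthant then exp (- V2 x) else 0)"
    and hom1: "\<And>t u. 0 < t \<Longrightarrow> u \<in> pos_orthant \<Longrightarrow> V1 (t *\<^sub>R u) = t powr - \<alpha> * V1 u"
    and hom2: "\<And>t u. 0 < t \<Longrightarrow> u \<in> pos_orthant \<Longrightarrow> V2 (t *\<^sub>R u) = t powr - \<alpha> * V2 u"
    and pos1: "\<And>u. u \<in> pos_min_one \<Longrightarrow> 0 < V1 u"
    and pos2: "\<And>u. u \<in> pos_min_one \<Longrightarrow> 0 < V2 u"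
  shows "kolmogorov_dist F1 F2 = (SUP u \<in> pos_min_one. omega (\<bar>V1 u - V2 u\<bar> / min (V1 u) (V2 u)))"
    (is "_ = (SUP u \<in> _. ?W u)")
proof (rule antisym)
  have scaled: "\<bar>F1 (t *\<^sub>R u) - F2 (t *\<^sub>R u)\<bar>
      = \<bar>exp (- (t powr - \<alpha> * V1 u)) - exp (- (t powr - \<alpha> * V2 u))\<bar>"
    if "0 < t" "u \<in> pos_min_one" for t u
  proof -
    have "t *\<^sub>R u \<in> pos_orthant" "u \<in> pos_orthant"
      using that pos_min_one_subset[of u] by (auto simp: pos_orthant_def)
    then show ?thesis by (simp add: F1 F2 hom1 hom2 that)
  qed
  have attained: "\<exists>x. \<bar>F1 x - F2 x\<bar> = ?W u" if u: "u \<in> pos_min_one" for u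
  proof -
    obtain r where r: "0 < r" "\<bar>exp (- (r * V1 u)) - exp (- (r * V2 u))\<bar> = ?W u"
      using abs_exp_diff_eq_omega[OF pos1[OF u] pos2[OF u]] by blast
    \<comment> \<open>The scale \<open>t = r\<^bsup>-1/\<alpha>\<^esup>\<close> is chosen so that \<open>t\<^bsup>-\<alpha>\<^esup> = r\<close>.\<close>
    have "(r powr (- 1 / \<alpha>)) powr - \<alpha> = r" using r(1) \<alpha> by (simp add: powr_powr)
    then have "\<bar>F1 (r powr (- 1 / \<alpha>) *\<^sub>R u) - F2 (r powr (- 1 / \<alpha>) *\<^sub>R u)\<bar> = ?W u"
      using scaled[of "r powr (- 1 / \<alpha>)" u] r u by simp
    then show ?thesis by blast
  qed
  have V0: "0 < V1 x \<and> 0 < V2 x" if x: "x \<in> pos_orthant" for x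
  proof -
    obtain t u where tu: "0 < t" "u \<in> pos_min_one" "x = t *\<^sub>R u" by (rule pos_orthant_scaled[OF x])
    then show ?thesis using hom1 hom2 pos1 pos2 pos_min_one_subset[of u] by simp
  qed
  \<comment> \<open>Both functions have values in \<open>[0, 1]\<close>, so both suprema are finite.\<close>
  have le1: "\<bar>F1 x - F2 x\<bar> \<le> 1" for x
  proof (cases "x \<in> pos_orthant")
    case True
    then have "exp (- V1 x) \<le> 1" "exp (- V2 x) \<le> 1" using V0[of x] by simp_all
    then have "\<bar>exp (- V1 x) - exp (- V2 x)\<bar> \<le> 1"
      using exp_gt_zero[of "- V1 x"] exp_gt_zero[of "- V2 x"] by linarith
    then show ?thesis using True by (simp add: F1 F2)
  qed (simp add: F1 F2)
  have bdd: "bdd_above (range (\<lambda>x. \<bar>F1 x - F2 x\<bar>))" by (rule bdd_aboveI2[OF le1])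
  have bddW: "bdd_above (?W ` pos_min_one)"
    by (rule bdd_aboveI2[of _ _ 1]) (metis attained le1)
  show "kolmogorov_dist F1 F2 \<le> (SUP u \<in> pos_min_one. ?W u)"
    unfolding kolmogorov_dist_def
  proof (rule cSUP_least)
    fix x :: "real ^ 'd"
    show "\<bar>F1 x - F2 x\<bar> \<le> (SUP u \<in> pos_min_one. ?W u)"
    proof (cases "x \<in> pos_orthant")
      case True
      then obtain t u where tu: "0 < t" "u \<in> pos_min_one" "x = t *\<^sub>R u" by (rule pos_orthant_scaled)
      have "\<bar>F1 x - F2 x\<bar> \<le> ?W u"
        unfolding tu(3) scaled[OF tu(1,2)]
        by (rule abs_exp_diff_le_omega[OF pos1[OF tu(2)] pos2[OF tu(2)]]) simp
      also have "\<dots> \<le> (SUP u \<in> pos_min_one. ?W u)" by (rule cSUP_upper[OF tu(2) bddW])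
      finally show ?thesis .
    next
      case False
      obtain u :: "real ^ 'd" where u: "u \<in> pos_min_one" using pos_min_one_nonempty by blast
      have "\<bar>F1 x - F2 x\<bar> = 0" using False by (simp add: F1 F2)
      also have "0 \<le> ?W u" using attained[OF u] by (metis abs_ge_zero)
      also have "\<dots> \<le> (SUP u \<in> pos_min_one. ?W u)" by (rule cSUP_upper[OF u bddW])
      finally show ?thesis .
    qed
  qed simp
  show "(SUP u \<in> pos_min_one. ?W u) \<le> kolmogorov_dist F1 F2"
    unfolding kolmogorov_dist_def
  proof (rule cSUP_least[OF pos_min_one_nonempty])
    fix u :: "real ^ 'd" assume "u \<in> pos_min_one"
    then obtain x where "\<bar>F1 x - F2 x\<bar> = ?W u" using attained by blast
    then show "?W u \<le> (SUP x. \<bar>F1 x - F2 x\<bar>)" using cSUP_upper[OF UNIV_I bdd, of x] by simp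
  qed
qed

section \<open>Total variation of angular measures\<close>

lemma tv_dist_upper:
  assumes "finite_measure H1" "finite_measure H2" "A \<in> sets (restrict_space borel S)"
  shows "\<bar>measure H1 A - measure H2 A\<bar> \<le> tv_dist S H1 H2"
  unfolding tv_dist_def
proof (rule cSUP_upper[OF assms(3)])
  interpret H1: finite_measure H1 by fact
  interpret H2: finite_measure H2 by fact
  show "bdd_above ((\<lambda>A. \<bar>measure H1 A - measure H2 A\<bar>) ` sets (restrict_space borel S))"
  proof (rule bdd_aboveI2)
    fix A
    show "\<bar>measure H1 A - measure H2 A\<bar> \<le> measure H1 (space H1) + measure H2 (space H2)"
      using H1.bounded_measure[of A] H2.bounded_measure[of A]
        measure_nonneg[of H1 A] measure_nonneg[of H2 A] by linarith
  qed
qed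

lemma tv_dist_nonneg:
  assumes "finite_measure H1" "finite_measure H2"
  shows "0 \<le> tv_dist S H1 H2"
  using tv_dist_upper[OF assms sets.empty_sets] by simp

text \<open>
  For \<open>0 \<le> y \<le> K\<close>, the number of levels \<open>k K / n\<close> with \<open>1 \<le> k \<le> n\<close> that do not exceed \<open>y\<close> is the integer
  part of \<open>y n / K\<close>.
\<close>

lemma sum_layers_bounds:
  fixes y :: real and n :: nat
  assumes "0 < n" "0 < K" "0 \<le> y" "y \<le> K"
  defines "L \<equiv> K / n * (\<Sum>k = 1..n. indicator {real k * K / n..} y)"
  shows "L \<le> y" "y - K / n \<le> L"
proof -
  define z where "z = y * n / K"
  have z: "0 \<le> z" "z \<le> n" using assms by (auto simp: z_def field_simps)
  have y: "y = K / n * z" using assms by (simp add: z_def)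
  have "indicator {real k * K / n..} y = (of_bool (k \<le> nat \<lfloor>z\<rfloor>) :: real)" for k :: nat
  proof -
    have "real k * K / n \<le> y \<longleftrightarrow> real k \<le> z" using assms by (simp add: z_def field_simps)
    also have "\<dots> \<longleftrightarrow> k \<le> nat \<lfloor>z\<rfloor>" using z by (simp add: le_nat_floor le_nat_iff le_floor_iff)
    finally show ?thesis by (simp add: indicator_def)
  qed
  then have "(\<Sum>k = 1..n. indicator {real k * K / n..} y) = (\<Sum>k\<in>{1..n}. of_bool (k \<le> nat \<lfloor>z\<rfloor>) :: real)"
    by simp
  also have "\<dots> = card ({1..n} \<inter> {k. k \<le> nat \<lfloor>z\<rfloor>})" by simp
  also have "{1..n} \<inter> {k. k \<le> nat \<lfloor>z\<rfloor>} = {1..nat \<lfloor>z\<rfloor>}" using z by (auto simp: nat_le_iff floor_le_iff) linarith+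
  finally have "L = K / n * of_int \<lfloor>z\<rfloor>" using z by (simp add: L_def)
  moreover have "K / n * of_int \<lfloor>z\<rfloor> \<le> K / n * z" "K / n * (z - 1) \<le> K / n * of_int \<lfloor>z\<rfloor>"
    using assms by (intro mult_left_mono; (simp, linarith?))+
  moreover have "K / n * (z - 1) = K / n * z - K / n" by (simp only: right_diff_distrib mult_1_right)
  ultimately show "L \<le> y" "y - K / n \<le> L" unfolding y by linarith+
qed

lemma gauge_representer_measurable:
  assumes R: "de_haan_representer \<alpha> M Z F" and G: "admissible_gauge \<tau>"
  shows "(\<lambda>w. \<tau> (Z w)) \<in> borel_measurable M"
proof -
  have "Z \<in> M \<rightarrow>\<^sub>M restrict_space borel nonneg_orthant"
    using de_haan_representerD[OF R] by (intro measurable_restrict_space2) auto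
  moreover have "\<tau> \<in> restrict_space borel nonneg_orthant \<rightarrow>\<^sub>M borel"
    using G by (simp add: admissible_gauge_def)
  ultimately show ?thesis by (rule measurable_compose)
qed

lemma integrable_gauge_representer:
  fixes Z :: "'a \<Rightarrow> real ^ 'd"
  assumes R: "de_haan_representer \<alpha> M Z F" and G: "admissible_gauge \<tau>" and \<alpha>: "0 < \<alpha>"
  shows "integrable M (\<lambda>w. \<tau> (Z w) powr \<alpha>)"
proof -
  obtain b where b: "0 < b" "\<And>x. x \<in> nonneg_orthant \<Longrightarrow> \<tau> x \<le> b * infnorm x"
    using admissible_gaugeE[OF G] by (metis less_le_trans)
  show ?thesis
  proof (rule Bochner_Integration.integrable_bound)
    show "integrable M (\<lambda>w. b powr \<alpha> * (\<Sum>j\<in>UNIV. (Z w $ j) powr \<alpha>))"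
      by (intro integrable_mult_right Bochner_Integration.integrable_sum integrable_representer_component[OF R])
    show "(\<lambda>w. \<tau> (Z w) powr \<alpha>) \<in> borel_measurable M"
      using gauge_representer_measurable[OF R G] by measurable
    show "AE w in M. norm (\<tau> (Z w) powr \<alpha>) \<le> norm (b powr \<alpha> * (\<Sum>j\<in>UNIV. (Z w $ j) powr \<alpha>))"
    proof (rule AE_I2)
      fix w assume "w \<in> space M"
      then have Zw: "Z w \<in> nonneg_orthant" by (rule de_haan_representerD(3)[OF R])
      then have abs: "\<bar>Z w $ j\<bar> = Z w $ j" for j by (simp add: nonneg_orthant_def)
      have "0 \<le> \<tau> (Z w)" using Zw G by (simp add: admissible_gauge_def)
      then have "\<tau> (Z w) powr \<alpha> \<le> (b * infnorm (Z w)) powr \<alpha>"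
        using \<alpha> b(2)[OF Zw] by (intro powr_mono2) auto
      also have "\<dots> = b powr \<alpha> * infnorm (Z w) powr \<alpha>"
        using b(1) by (simp add: powr_mult infnorm_pos_le)
      also have "\<dots> \<le> b powr \<alpha> * (\<Sum>j\<in>UNIV. (Z w $ j) powr \<alpha>)"
        using infnorm_powr_le_lgauge[OF \<alpha>, of "Z w"]
        by (intro mult_left_mono) (simp_all add: lgauge_powr[OF \<alpha>] abs)
      finally show "norm (\<tau> (Z w) powr \<alpha>) \<le> norm (b powr \<alpha> * (\<Sum>j\<in>UNIV. (Z w $ j) powr \<alpha>))"
        by (simp add: sum_nonneg)
    qed
  qed
qed

text \<open>
  The first integral is that of \<open>g\<close> against the angular measure \<open>H\<close>, in polar coordinates
  \<open>\<tau>(Z)\<close> and \<open>Z / \<tau>(Z)\<close>. The discrete layer-cake sum misses it by at most one layer height times the total mass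
  of \<open>H\<close>. Where \<open>Z = 0\<close>, the direction \<open>Z / \<tau>(Z)\<close> is the zero vector and not on the sphere, but the
  weight \<open>\<tau>(Z)\<^sup>\<alpha>\<close> vanishes, so these points need no separate null-set argument.
\<close>

lemma polar_integral_layers:
  fixes Z :: "'a \<Rightarrow> real ^ 'd" and g :: "real ^ 'd \<Rightarrow> real" and n :: nat
  assumes \<alpha>: "0 < \<alpha>" and R: "de_haan_representer \<alpha> M Z F" and G: "admissible_gauge \<tau>"
    and A: "is_angular_measure \<alpha> \<tau> M Z H"
    and g[measurable]: "g \<in> borel_measurable borel"
    and gK: "\<And>s. s \<in> pos_sphere \<tau> \<Longrightarrow> 0 \<le> g s \<and> g s \<le> K"
    and K: "0 < K" and n: "0 < n"
  shows "\<bar>(\<integral>w. \<tau> (Z w) powr \<alpha> * g ((1 / \<tau> (Z w)) *\<^sub>R Z w) \<partial>M)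
      - K / n * (\<Sum>k = 1..n. measure H {s \<in> pos_sphere \<tau>. real k * K / n \<le> g s})\<bar>
    \<le> K / n * (\<integral>w. \<tau> (Z w) powr \<alpha> \<partial>M)"
proof -
  define T where "T w = \<tau> (Z w) powr \<alpha>" for w
  define \<Theta> where "\<Theta> w = (1 / \<tau> (Z w)) *\<^sub>R Z w" for w
  define B where "B k = {s \<in> pos_sphere \<tau>. real k * K / n \<le> g s}" for k :: nat
  define L where "L w = K / n * (\<Sum>k = 1..n. T w * indicator (B k) (\<Theta> w))" for w
  have T0: "0 \<le> T w" for w by (simp add: T_def)
  have [measurable]: "Z \<in> borel_measurable M" by (rule de_haan_representerD(2)[OF R])
  have [measurable]: "(\<lambda>w. \<tau> (Z w)) \<in> borel_measurable M" by (rule gauge_representer_measurable[OF R G])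
  have [measurable]: "T \<in> borel_measurable M" "\<Theta> \<in> borel_measurable M"
    unfolding T_def \<Theta>_def by measurable
  have [measurable]: "pos_sphere \<tau> \<in> sets borel" by (rule pos_sphere_sets[OF G])
  have B_borel[measurable]: "B k \<in> sets borel" for k unfolding B_def by measurable
  have B_sets: "B k \<in> sets H" for k
    using A B_borel[of k] by (auto simp: is_angular_measure_def sets_restrict_space_iff B_def)
  have intT: "integrable M T" unfolding T_def by (rule integrable_gauge_representer[OF R G \<alpha>])
  have intB: "integrable M (\<lambda>w. T w * indicator (B k) (\<Theta> w))" for k
    by (rule Bochner_Integration.integrable_bound[OF intT]) (auto simp: indicator_def)
  have intL: "integrable M L" unfolding L_def
    by (intro integrable_mult_right Bochner_Integration.integrable_sum intB)
  have \<Theta>: "\<Theta> w \<in> pos_sphere \<tau>" if "w \<in> space M" "T w \<noteq> 0" for w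
  proof -
    have "Z w \<in> nonneg_orthant" by (rule de_haan_representerD(3)[OF R that(1)])
    moreover from this have "Z w \<noteq> 0"
      using that(2) admissible_gauge_eq_0_iff[OF G, of 0] by (auto simp: T_def nonneg_orthant_def)
    ultimately show ?thesis unfolding \<Theta>_def by (rule admissible_gauge_normalized(2)[OF G])
  qed
  have layers: "L w \<le> T w * g (\<Theta> w) \<and> T w * g (\<Theta> w) - L w \<le> K / n * T w" if w: "w \<in> space M" for w
  proof (cases "T w = 0")
    case True
    then show ?thesis by (simp add: L_def)
  next
    case False
    have s: "\<Theta> w \<in> pos_sphere \<tau>" by (rule \<Theta>[OF w False])
    then have "indicator (B k) (\<Theta> w) = (indicator {real k * K / n..} (g (\<Theta> w)) :: real)" for k
      by (simp add: B_def indicator_def)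
    then have L: "L w = T w * (K / n * (\<Sum>k = 1..n. indicator {real k * K / n..} (g (\<Theta> w))))"
      by (simp only: L_def sum_distrib_left[symmetric]) (rule mult.left_commute)
    have "L w \<le> T w * g (\<Theta> w)" "T w * (g (\<Theta> w) - K / n) \<le> L w"
      unfolding L using gK[OF s] K n
      by (intro mult_left_mono[OF _ T0] sum_layers_bounds; simp)+
    then show ?thesis by (simp add: algebra_simps)
  qed
  have "integrable M (\<lambda>w. L w + (T w * g (\<Theta> w) - L w))"
  proof (rule Bochner_Integration.integrable_add[OF intL])
    show "integrable M (\<lambda>w. T w * g (\<Theta> w) - L w)"
    proof (rule Bochner_Integration.integrable_bound)
      show "integrable M (\<lambda>w. K / n * T w)" by (intro integrable_mult_right intT)
      show "(\<lambda>w. T w * g (\<Theta> w) - L w) \<in> borel_measurable M" unfolding L_def by measurable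
      show "AE w in M. norm (T w * g (\<Theta> w) - L w) \<le> norm (K / n * T w)"
      proof (rule AE_I2)
        fix w assume "w \<in> space M"
        from layers[OF this] show "norm (T w * g (\<Theta> w) - L w) \<le> norm (K / n * T w)"
          unfolding real_norm_def by linarith
      qed
    qed
  qed
  then have intg: "integrable M (\<lambda>w. T w * g (\<Theta> w))" by simp
  have "measure H (B k) = (\<integral>w. T w * indicator (B k) (\<Theta> w) \<partial>M)" for k
    using A B_sets[of k] by (simp add: is_angular_measure_def T_def \<Theta>_def)
  then have "K / n * (\<Sum>k = 1..n. measure H (B k)) = (\<integral>w. L w \<partial>M)"
    unfolding L_def by (simp only: integral_mult_right_zero Bochner_Integration.integral_sum[OF intB])
  moreover have "(\<integral>w. L w \<partial>M) \<le> (\<integral>w. T w * g (\<Theta> w) \<partial>M)"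
    using layers by (intro integral_mono intL intg) auto
  moreover have "(\<integral>w. T w * g (\<Theta> w) - L w \<partial>M) \<le> (\<integral>w. K / n * T w \<partial>M)"
    using layers by (intro integral_mono integrable_mult_right intT Bochner_Integration.integrable_diff intL intg) auto
  ultimately have "\<bar>(\<integral>w. T w * g (\<Theta> w) \<partial>M) - K / n * (\<Sum>k = 1..n. measure H (B k))\<bar>
      \<le> K / n * (\<integral>w. T w \<partial>M)"
    by (simp add: Bochner_Integration.integral_diff[OF intg intL])
  then show ?thesis by (simp add: T_def \<Theta>_def B_def)
qed

lemma polar_integral_diff_le_tv_dist:
  fixes Z1 :: "'a \<Rightarrow> real ^ 'd" and Z2 :: "'b \<Rightarrow> real ^ 'd" and g :: "real ^ 'd \<Rightarrow> real"
  assumes \<alpha>: "0 < \<alpha>" and G: "admissible_gauge \<tau>"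
    and R1: "de_haan_representer \<alpha> M1 Z1 F1" and A1: "is_angular_measure \<alpha> \<tau> M1 Z1 H1"
    and R2: "de_haan_representer \<alpha> M2 Z2 F2" and A2: "is_angular_measure \<alpha> \<tau> M2 Z2 H2"
    and g: "g \<in> borel_measurable borel"
    and gK: "\<And>s. s \<in> pos_sphere \<tau> \<Longrightarrow> 0 \<le> g s \<and> g s \<le> K"
    and K: "0 < K"
  shows "\<bar>(\<integral>w. \<tau> (Z1 w) powr \<alpha> * g ((1 / \<tau> (Z1 w)) *\<^sub>R Z1 w) \<partial>M1)
      - (\<integral>w. \<tau> (Z2 w) powr \<alpha> * g ((1 / \<tau> (Z2 w)) *\<^sub>R Z2 w) \<partial>M2)\<bar>
    \<le> K * tv_dist (pos_sphere \<tau>) H1 H2" (is "\<bar>?I1 - ?I2\<bar> \<le> K * ?tv")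
proof -
  define C where "C = (\<integral>w. \<tau> (Z1 w) powr \<alpha> \<partial>M1) + (\<integral>w. \<tau> (Z2 w) powr \<alpha> \<partial>M2)"
  have fin: "finite_measure H1" "finite_measure H2" using A1 A2 by (auto simp: is_angular_measure_def)
  have approx: "\<bar>?I1 - ?I2\<bar> \<le> K * C / real n + K * ?tv" if n: "0 < n" for n :: nat
  proof -
    define B where "B k = {s \<in> pos_sphere \<tau>. real k * K / n \<le> g s}" for k :: nat
    have B: "B k \<in> sets (restrict_space borel (pos_sphere \<tau>))" for k
    proof -
      have [measurable]: "pos_sphere \<tau> \<in> sets borel" "g \<in> borel_measurable borel"
        by (rule pos_sphere_sets[OF G] g)+
      have "B k \<in> sets borel" unfolding B_def by measurable
      then show ?thesis by (auto simp: sets_restrict_space_iff B_def pos_sphere_sets[OF G])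
    qed
    have "\<bar>(\<Sum>k = 1..n. measure H1 (B k)) - (\<Sum>k = 1..n. measure H2 (B k))\<bar>
        \<le> (\<Sum>k = 1..n. \<bar>measure H1 (B k) - measure H2 (B k)\<bar>)"
      unfolding sum_subtractf[symmetric] by (rule sum_abs)
    also have "\<dots> \<le> (\<Sum>k = 1..n. ?tv)" by (intro sum_mono tv_dist_upper fin B)
    finally have "K / n * \<bar>(\<Sum>k = 1..n. measure H1 (B k)) - (\<Sum>k = 1..n. measure H2 (B k))\<bar>
        \<le> K / n * (n * ?tv)" using K by (intro mult_left_mono) auto
    also have "K / n * (n * ?tv) = K * ?tv" using n by simp
    finally have "\<bar>K / n * (\<Sum>k = 1..n. measure H1 (B k)) - K / n * (\<Sum>k = 1..n. measure H2 (B k))\<bar> \<le> K * ?tv"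
      using K by (simp only: right_diff_distrib[symmetric] abs_mult) simp
    moreover note polar_integral_layers[OF \<alpha> R1 G A1 g gK K n] polar_integral_layers[OF \<alpha> R2 G A2 g gK K n]
    ultimately have "\<bar>?I1 - ?I2\<bar> \<le> K / n * (\<integral>w. \<tau> (Z1 w) powr \<alpha> \<partial>M1)
        + K / n * (\<integral>w. \<tau> (Z2 w) powr \<alpha> \<partial>M2) + K * ?tv"
      unfolding B_def by linarith
    then show ?thesis by (simp add: C_def algebra_simps add_divide_distrib)
  qed
  have "(\<lambda>n. K * C / real n + K * ?tv) \<longlonglongrightarrow> 0 + K * ?tv"
    by (intro tendsto_add lim_const_over_n tendsto_const)
  then have "\<bar>?I1 - ?I2\<bar> \<le> 0 + K * ?tv"
    by (rule LIMSEQ_le_const) (use approx in \<open>auto intro!: exI[of _ 1]\<close>)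
  then show ?thesis by simp
qed

text \<open>
  The identity holds pointwise under the integral, also where \<open>Z = 0\<close>: both sides vanish there.
\<close>

lemma exponent_function_polar:
  fixes Z :: "'a \<Rightarrow> real ^ 'd"
  assumes \<alpha>: "0 < \<alpha>" and R: "de_haan_representer \<alpha> M Z F" and G: "admissible_gauge \<tau>"
  shows "exponent_function \<alpha> M Z u =
    (\<integral>w. \<tau> (Z w) powr \<alpha> * (MAX j. (((1 / \<tau> (Z w)) *\<^sub>R Z w) $ j) powr \<alpha> / (u $ j) powr \<alpha>) \<partial>M)"
  unfolding exponent_function_def
proof (rule Bochner_Integration.integral_cong[OF refl])
  fix w assume "w \<in> space M"
  then have Zw: "Z w \<in> nonneg_orthant" by (rule de_haan_representerD(3)[OF R])
  then have nn: "0 \<le> Z w $ j" for j by (simp add: nonneg_orthant_def)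
  have "(Z w $ j) powr \<alpha> = \<tau> (Z w) powr \<alpha> * (((1 / \<tau> (Z w)) *\<^sub>R Z w) $ j) powr \<alpha>" for j
  proof (cases "Z w = 0")
    case True
    then show ?thesis by simp
  next
    case False
    then have "0 < \<tau> (Z w)" by (rule admissible_gauge_normalized(1)[OF G Zw])
    then show ?thesis using nn[of j] by (simp add: powr_mult[symmetric])
  qed
  then show "(MAX j. (Z w $ j) powr \<alpha> / (u $ j) powr \<alpha>) = \<tau> (Z w) powr \<alpha> *
      (MAX j. (((1 / \<tau> (Z w)) *\<^sub>R Z w) $ j) powr \<alpha> / (u $ j) powr \<alpha>)"
    by (simp only: Max_range_mult[OF powr_ge_zero, symmetric] times_divide_eq_right)
qed

lemma exponent_function_diff_le_tv_dist:
  fixes Z1 :: "'a \<Rightarrow> real ^ 'd" and Z2 :: "'b \<Rightarrow> real ^ 'd"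
  assumes \<alpha>: "0 < \<alpha>" and G: "admissible_gauge \<tau>"
    and R1: "de_haan_representer \<alpha> M1 Z1 F1" and A1: "is_angular_measure \<alpha> \<tau> M1 Z1 H1"
    and R2: "de_haan_representer \<alpha> M2 Z2 F2" and A2: "is_angular_measure \<alpha> \<tau> M2 Z2 H2"
    and u: "u \<in> pos_min_one"
  shows "\<bar>exponent_function \<alpha> M1 Z1 u - exponent_function \<alpha> M2 Z2 u\<bar>
    \<le> M_infty \<alpha> (pos_sphere \<tau>) * tv_dist (pos_sphere \<tau>) H1 H2"
proof -
  have bdd: "bdd_above ((\<lambda>s. infnorm s powr \<alpha>) ` pos_sphere \<tau>)"
  proof -
    obtain B where "\<And>s. s \<in> pos_sphere \<tau> \<Longrightarrow> lgauge \<alpha> s powr \<alpha> \<le> B"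
      using bdd_above_lgauge_pos_sphere[OF \<alpha> G] by (auto simp: bdd_above_def)
    then show ?thesis
      by (intro bdd_aboveI2[of _ _ B]) (meson infnorm_powr_le_lgauge[OF \<alpha>] order_trans)
  qed
  have K: "infnorm s powr \<alpha> \<le> M_infty \<alpha> (pos_sphere \<tau>)" if "s \<in> pos_sphere \<tau>" for s
    unfolding M_infty_def by (rule cSUP_upper[OF that bdd])
  have Kpos: "0 < M_infty \<alpha> (pos_sphere \<tau>)"
  proof -
    obtain s where s: "s \<in> pos_sphere \<tau>" using pos_sphere_nonempty[OF G] by blast
    then have "s \<noteq> 0" using admissible_gauge_eq_0_iff[OF G, of s] by (auto simp: pos_sphere_def)
    then have "0 < infnorm s powr \<alpha>" by (simp add: infnorm_eq_0)
    then show ?thesis using K[OF s] by linarith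
  qed
  define g where "g s = (MAX j. (s $ j) powr \<alpha> / (u $ j) powr \<alpha>)" for s :: "real ^ 'd"
  have gm: "g \<in> borel_measurable borel" unfolding g_def by measurable
  have gK: "0 \<le> g s \<and> g s \<le> M_infty \<alpha> (pos_sphere \<tau>)" if s: "s \<in> pos_sphere \<tau>" for s
  proof
    show "0 \<le> g s" unfolding g_def by (rule Max_range_nonneg) simp
    have "(s $ j) powr \<alpha> / (u $ j) powr \<alpha> \<le> M_infty \<alpha> (pos_sphere \<tau>)" for j
    proof -
      have "1 \<le> (u $ j) powr \<alpha>" using u \<alpha> by (simp add: pos_min_one_iff ge_one_powr_ge_zero)
      then have "(s $ j) powr \<alpha> / (u $ j) powr \<alpha> \<le> (s $ j) powr \<alpha>"
        by (simp add: divide_le_eq mult_le_cancel_left1)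
      also have "\<dots> \<le> infnorm s powr \<alpha>"
        using \<alpha> s component_le_infnorm_cart[of s j]
        by (intro powr_mono2) (auto simp: pos_sphere_def nonneg_orthant_def)
      also note K[OF s]
      finally show ?thesis .
    qed
    then show "g s \<le> M_infty \<alpha> (pos_sphere \<tau>)" unfolding g_def by (intro Max.boundedI) auto
  qed
  show ?thesis
    unfolding exponent_function_polar[OF \<alpha> R1 G] exponent_function_polar[OF \<alpha> R2 G]
    using polar_integral_diff_le_tv_dist[OF \<alpha> G R1 A1 R2 A2 gm gK Kpos] by (simp only: g_def)
qed

section \<open>Comparison of two max-stable distribution functions\<close>

theorem mainTheorem2:
  fixes \<alpha> :: real
    and F1 F2 V1 V2 :: "real ^ 'd \<Rightarrow> real"
    and M1 :: "'a measure" and Z1 :: "'a \<Rightarrow> real ^ 'd"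
    and M2 :: "'b measure" and Z2 :: "'b \<Rightarrow> real ^ 'd"
    and \<tau> :: "real ^ 'd \<Rightarrow> real"
    and S :: "(real ^ 'd) set"
    and H1 H2 :: "(real ^ 'd) measure"
  assumes "0 < \<alpha>"
    and "max_stable_frechet \<alpha> F1" and "max_stable_frechet \<alpha> F2"
    and "de_haan_representer \<alpha> M1 Z1 F1" and "de_haan_representer \<alpha> M2 Z2 F2"
    and "\<And>x. x \<in> pos_orthant \<Longrightarrow> V1 x = exponent_function \<alpha> M1 Z1 x"
    and "\<And>x. x \<in> pos_orthant \<Longrightarrow> V2 x = exponent_function \<alpha> M2 Z2 x"
    and "is_norm \<tau> \<or> admissible_gauge \<tau>"
    and "S = pos_sphere \<tau>"
    and "is_angular_measure \<alpha> \<tau> M1 Z1 H1" and "is_angular_measure \<alpha> \<tau> M2 Z2 H2"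
  shows
    "(let \<Delta>V = (SUP u \<in> pos_min_one. \<bar>V1 u - V2 u\<bar>) in
        kolmogorov_dist F1 F2 =
          (SUP u \<in> pos_min_one. omega (\<bar>V1 u - V2 u\<bar> / min (V1 u) (V2 u))) \<and>
        (SUP u \<in> pos_min_one. omega (\<bar>V1 u - V2 u\<bar> / min (V1 u) (V2 u))) \<le> omega \<Delta>V \<and>
        omega \<Delta>V \<le> \<Delta>V / exp 1)
     \<and>
     (\<forall>\<Psi>1 \<Psi>2 :: 'd \<Rightarrow> real ^ 'd \<Rightarrow> real.
        (\<forall>x \<in> pos_orthant. V1 x = (\<Sum>j\<in>UNIV. (x $ j) powr (- \<alpha>) * \<Psi>1 j x)) \<and>
        (\<forall>x \<in> pos_orthant. V2 x = (\<Sum>j\<in>UNIV. (x $ j) powr (- \<alpha>) * \<Psi>2 j x)) \<longrightarrow>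
        (let \<Delta>\<Psi> = (SUP x \<in> pos_min_one.
                      \<bar>\<Sum>j\<in>UNIV. (x $ j) powr (- \<alpha>) * (\<Psi>1 j x - \<Psi>2 j x)\<bar>) in
           kolmogorov_dist F1 F2 \<le> omega \<Delta>\<Psi> \<and>
           omega \<Delta>\<Psi> \<le> \<Delta>\<Psi> / exp 1 \<and>
           ereal \<Delta>\<Psi> \<le> (SUP x \<in> pos_min_one. ereal (\<Sum>j\<in>UNIV. \<bar>\<Psi>1 j x - \<Psi>2 j x\<bar>))))
     \<and>
     ((\<forall>N A. is_norm N \<and> S = pos_sphere N \<and> 0 < A \<and>
          (\<forall>x \<in> nonneg_orthant. A * infnorm x \<le> N x) \<longrightarrow>
          M_infty \<alpha> S \<le> A powr (- \<alpha>)) \<and>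
      (\<forall>p\<ge>1. M_infty \<alpha> (pos_sphere (lgauge p) :: (real ^ 'd) set) = 1) \<and>
      M_infty \<alpha> (pos_sphere infnorm :: (real ^ 'd) set) = 1 \<and>
      M_infty \<alpha> S \<le> M_alpha \<alpha> S \<and>
      kolmogorov_dist F1 F2 \<le> M_alpha \<alpha> S / exp 1 * tv_dist S H1 H2)
     \<and>
     M_infty \<alpha> {s \<in> nonneg_orthant :: (real ^ 'd) set. (\<Sum>j\<in>UNIV. (s $ j) powr \<alpha>) = 1} = 1"
proof -
  note \<alpha> = assms(1) and R1 = assms(4) and R2 = assms(5) and V1 = assms(6) and V2 = assms(7)
    and S = assms(9) and A1 = assms(10) and A2 = assms(11)
  have G: "admissible_gauge \<tau>" using assms(8) is_norm_imp_admissible_gauge by blast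
  define \<Delta> where "\<Delta> = (SUP u \<in> pos_min_one. \<bar>V1 u - V2 u\<bar>)"
  define W where "W = (SUP u \<in> pos_min_one. omega (\<bar>V1 u - V2 u\<bar> / min (V1 u) (V2 u)))"
  have bounds: "1 \<le> V1 u" "V1 u \<le> CARD('d)" "1 \<le> V2 u" "V2 u \<le> CARD('d)" if "u \<in> pos_min_one" for u
    using exponent_function_bounds[OF R1 \<alpha> that] exponent_function_bounds[OF R2 \<alpha> that]
    by (simp_all add: V1 V2 pos_min_one_subset that)
  have bdd: "bdd_above ((\<lambda>u. \<bar>V1 u - V2 u\<bar>) ` pos_min_one)"
  proof (rule bdd_aboveI2)
    fix u :: "real ^ 'd" assume "u \<in> pos_min_one"
    from bounds[OF this] show "\<bar>V1 u - V2 u\<bar> \<le> CARD('d)" by linarith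
  qed
  have \<Delta>_upper: "\<bar>V1 u - V2 u\<bar> \<le> \<Delta>" if "u \<in> pos_min_one" for u
    unfolding \<Delta>_def by (rule cSUP_upper[OF that bdd])
  have \<Delta>0: "0 \<le> \<Delta>"
  proof -
    obtain u :: "real ^ 'd" where "u \<in> pos_min_one" using pos_min_one_nonempty by blast
    from \<Delta>_upper[OF this] show ?thesis by linarith
  qed
  have dist_eq: "kolmogorov_dist F1 F2 = W"
    unfolding W_def
  proof (rule kolmogorov_dist_homogeneous[OF \<alpha>])
    show "F1 x = (if x \<in> pos_orthant then exp (- V1 x) else 0)" for x
      using de_haan_representerD(5)[OF R1, of x] V1[of x] by simp
    show "F2 x = (if x \<in> pos_orthant then exp (- V2 x) else 0)" for x
      using de_haan_representerD(5)[OF R2, of x] V2[of x] by simp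
    fix t :: real and u :: "real ^ 'd" assume tu: "0 < t" "u \<in> pos_orthant"
    then have "t *\<^sub>R u \<in> pos_orthant" by (simp add: pos_orthant_def)
    then show "V1 (t *\<^sub>R u) = t powr - \<alpha> * V1 u" "V2 (t *\<^sub>R u) = t powr - \<alpha> * V2 u"
      using exponent_function_scale[OF tu] V1 V2 tu(2) by simp_all
  next
    fix u :: "real ^ 'd" assume "u \<in> pos_min_one"
    from bounds[OF this] show "0 < V1 u" "0 < V2 u" by simp_all
  qed
  have W_le: "W \<le> omega \<Delta>"
    unfolding W_def
  proof (rule cSUP_least[OF pos_min_one_nonempty])
    fix u :: "real ^ 'd" assume u: "u \<in> pos_min_one"
    have "\<bar>V1 u - V2 u\<bar> / min (V1 u) (V2 u) \<le> \<bar>V1 u - V2 u\<bar> / 1"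
      using bounds[OF u] by (intro divide_left_mono) auto
    also have "\<dots> \<le> \<Delta>" using \<Delta>_upper[OF u] by simp
    finally show "omega (\<bar>V1 u - V2 u\<bar> / min (V1 u) (V2 u)) \<le> omega \<Delta>"
      using bounds[OF u] by (intro omega_mono) auto
  qed
  have omega_\<Delta>: "omega \<Delta> \<le> \<Delta> / exp 1" by (rule omega_le[OF \<Delta>0])

  have i: "let \<Delta>V = (SUP u \<in> pos_min_one. \<bar>V1 u - V2 u\<bar>) in
        kolmogorov_dist F1 F2 =
          (SUP u \<in> pos_min_one. omega (\<bar>V1 u - V2 u\<bar> / min (V1 u) (V2 u))) \<and>
        (SUP u \<in> pos_min_one. omega (\<bar>V1 u - V2 u\<bar> / min (V1 u) (V2 u))) \<le> omega \<Delta>V \<and>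
        omega \<Delta>V \<le> \<Delta>V / exp 1"
    unfolding Let_def W_def[symmetric] \<Delta>_def[symmetric] using dist_eq W_le omega_\<Delta> by blast

  have ii: "let \<Delta>\<Psi> = (SUP x \<in> pos_min_one.
                      \<bar>\<Sum>j\<in>UNIV. (x $ j) powr (- \<alpha>) * (\<Psi>1 j x - \<Psi>2 j x)\<bar>) in
           kolmogorov_dist F1 F2 \<le> omega \<Delta>\<Psi> \<and>
           omega \<Delta>\<Psi> \<le> \<Delta>\<Psi> / exp 1 \<and>
           ereal \<Delta>\<Psi> \<le> (SUP x \<in> pos_min_one. ereal (\<Sum>j\<in>UNIV. \<bar>\<Psi>1 j x - \<Psi>2 j x\<bar>))"
    if \<Psi>1: "\<forall>x \<in> pos_orthant. V1 x = (\<Sum>j\<in>UNIV. (x $ j) powr (- \<alpha>) * \<Psi>1 j x)"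
      and \<Psi>2: "\<forall>x \<in> pos_orthant. V2 x = (\<Sum>j\<in>UNIV. (x $ j) powr (- \<alpha>) * \<Psi>2 j x)"
    for \<Psi>1 \<Psi>2 :: "'d \<Rightarrow> real ^ 'd \<Rightarrow> real"
  proof -
    have diff: "(\<Sum>j\<in>UNIV. (x $ j) powr (- \<alpha>) * (\<Psi>1 j x - \<Psi>2 j x)) = V1 x - V2 x"
      if "x \<in> pos_min_one" for x
      using \<Psi>1 \<Psi>2 pos_min_one_subset[OF that] by (simp add: right_diff_distrib sum_subtractf)
    then have eq: "(SUP x \<in> pos_min_one. \<bar>\<Sum>j\<in>UNIV. (x $ j) powr (- \<alpha>) * (\<Psi>1 j x - \<Psi>2 j x)\<bar>) = \<Delta>"
      unfolding \<Delta>_def by (intro SUP_cong) auto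
    let ?R = "SUP x \<in> pos_min_one. ereal (\<Sum>j\<in>UNIV. \<bar>\<Psi>1 j x - \<Psi>2 j x\<bar>)"
    have le: "ereal \<bar>V1 x - V2 x\<bar> \<le> ?R" if x: "x \<in> pos_min_one" for x
    proof -
      have "\<bar>V1 x - V2 x\<bar> \<le> (\<Sum>j\<in>UNIV. \<bar>(x $ j) powr (- \<alpha>) * (\<Psi>1 j x - \<Psi>2 j x)\<bar>)"
        unfolding diff[OF x, symmetric] by (rule sum_abs)
      also have "\<dots> \<le> (\<Sum>j\<in>UNIV. \<bar>\<Psi>1 j x - \<Psi>2 j x\<bar>)"
      proof (rule sum_mono)
        fix j
        have "(x $ j) powr (- \<alpha>) \<le> 1 powr (- \<alpha>)"
          using x \<alpha> by (intro powr_mono2') (auto simp: pos_min_one_iff)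
        then show "\<bar>(x $ j) powr (- \<alpha>) * (\<Psi>1 j x - \<Psi>2 j x)\<bar> \<le> \<bar>\<Psi>1 j x - \<Psi>2 j x\<bar>"
          by (simp add: abs_mult mult_left_le_one_le)
      qed
      finally have "ereal \<bar>V1 x - V2 x\<bar> \<le> ereal (\<Sum>j\<in>UNIV. \<bar>\<Psi>1 j x - \<Psi>2 j x\<bar>)" by simp
      also have "\<dots> \<le> ?R" by (rule SUP_upper[OF x])
      finally show ?thesis .
    qed
    have "ereal \<Delta> \<le> ?R"
    proof (cases "?R")
      case (real r)
      then have "\<bar>V1 x - V2 x\<bar> \<le> r" if "x \<in> pos_min_one" for x using le[OF that] by simp
      then have "\<Delta> \<le> r" unfolding \<Delta>_def by (intro cSUP_least pos_min_one_nonempty)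
      then show ?thesis unfolding real by simp
    next
      case PInf
      then show ?thesis by simp
    next
      case MInf
      obtain u :: "real ^ 'd" where "u \<in> pos_min_one" using pos_min_one_nonempty by blast
      from le[OF this] MInf show ?thesis by simp
    qed
    then show ?thesis unfolding Let_def eq using dist_eq W_le omega_\<Delta> by simp
  qed

  have iii_norm: "M_infty \<alpha> S \<le> A powr (- \<alpha>)"
    if "is_norm N" "S = pos_sphere N" "0 < A" "\<forall>x \<in> nonneg_orthant. A * infnorm x \<le> N x" for N A
  proof (rule M_infty_le[OF \<alpha> that(3)])
    show "S \<noteq> {}" unfolding S by (rule pos_sphere_nonempty[OF G])
    show "A * infnorm s \<le> 1" if "s \<in> S" for s
      using \<open>s \<in> S\<close> \<open>\<forall>x \<in> nonneg_orthant. A * infnorm x \<le> N x\<close>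
      unfolding \<open>S = pos_sphere N\<close> by (auto simp: pos_sphere_def)
  qed

  have iii_p: "M_infty \<alpha> (pos_sphere (lgauge p) :: (real ^ 'd) set) = 1" if "1 \<le> p" for p
    using that by (intro M_infty_lgauge_sphere[OF \<alpha>]) simp

  have iii_M: "M_infty \<alpha> S \<le> M_alpha \<alpha> S"
    unfolding S by (rule M_infty_le_M_alpha[OF \<alpha> G])

  have iii_tv: "kolmogorov_dist F1 F2 \<le> M_alpha \<alpha> S / exp 1 * tv_dist S H1 H2"
  proof -
    have "\<Delta> \<le> M_infty \<alpha> S * tv_dist S H1 H2"
      unfolding \<Delta>_def
    proof (rule cSUP_least[OF pos_min_one_nonempty])
      fix u :: "real ^ 'd" assume u: "u \<in> pos_min_one"
      then show "\<bar>V1 u - V2 u\<bar> \<le> M_infty \<alpha> S * tv_dist S H1 H2"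
        using exponent_function_diff_le_tv_dist[OF \<alpha> G R1 A1 R2 A2 u] pos_min_one_subset[OF u]
        by (simp add: V1 V2 S)
    qed
    also have "\<dots> \<le> M_alpha \<alpha> S * tv_dist S H1 H2"
      using A1 A2 by (intro mult_right_mono iii_M tv_dist_nonneg) (auto simp: is_angular_measure_def)
    finally have "\<Delta> / exp 1 \<le> M_alpha \<alpha> S * tv_dist S H1 H2 / exp 1"
      by (simp add: divide_right_mono)
    then show ?thesis using dist_eq W_le omega_\<Delta> by simp
  qed

  have iv: "M_infty \<alpha> {s \<in> nonneg_orthant :: (real ^ 'd) set. (\<Sum>j\<in>UNIV. (s $ j) powr \<alpha>) = 1} = 1"
    using M_infty_lgauge_sphere[OF \<alpha> \<alpha>] unfolding pos_sphere_lgauge[OF \<alpha>] .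

  show ?thesis
    using i ii iii_norm iii_p M_infty_infnorm_sphere[OF \<alpha>] iii_M iii_tv iv
    by (intro conjI) blast+
qed

end
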